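(* Let $d\ge2$, let $D\subset\mathbb{R}^d$ be a bounded domain, let $\mathbf{K}:D\to\mathbb{R}^{d\times d}$ be bounded, measurable, symmetric and strictly elliptic, and let $\Gamma_1\subset\partial D$ be a nonempty Borel set. Let $\sigma$ be the restriction of the $(d-1)$-dimensional Hausdorff measure to $\partial D$, and assume that for every $\mathbf{x}\in D$ the elliptic measure $\mu_{\mathbf{x}}$ associated with $\operatorname{div}(\mathbf{K}\nabla)$ in $D$ with pole $\mathbf{x}$ is absolutely continuous with respect to $\sigma$ with density $\rho_{\mathbf{x}}:=\frac{d\mu_{\mathbf{x}}}{d\sigma}\in L^2(\partial D,\sigma)$. Let $M_D\ge1$, let $\mathbf{x}^D_1,\dots,\mathbf{x}^D_{M_D}\in D$, and let $\boldsymbol{\nu}=(\nu_i)_{i=1}^{M_D}$ satisfy $\nu_i\in(0,1)$ and $\sum_{i=1}^{M_D}\nu_i^2=1$. Define $$T_{\boldsymbol{\nu}}:L^2(\Gamma_1,\sigma)\to\mathbb{R}^{M_D},\quad T_{\boldsymbol{\nu}}u=\Big(\nu_i\int_{\Gamma_1}u\,\rho_{\mathbf{x}^D_i}\,d\sigma\Big)_{i=1}^{M_D},\qquad \boldsymbol{\Lambda}^{\boldsymbol{\nu}}=\Big(\nu_i\nu_j\int_{\Gamma_1}\rho_{\mathbf{x}^D_i}\rho_{\mathbf{x}^D_j}\,d\sigma\Big)_{i,j=1}^{M_D},$$ where $\mathbb{R}^{M_D}$ carries the Euclidean inner product, so that $T_{\boldsymbol{\nu}}^*\mathbf{v}=\sum_{i=1}^{M_D}\nu_iv_i\,\rho_{\mathbf{x}^D_i}|_{\Gamma_1}$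 for $\mathbf{v}\in\mathbb{R}^{M_D}$. Then $$T_{\boldsymbol{\nu}}T_{\boldsymbol{\nu}}^*=\boldsymbol{\Lambda}^{\boldsymbol{\nu}},$$ and in particular: (i) $\boldsymbol{\Lambda}^{\boldsymbol{\nu}}$ and $T_{\boldsymbol{\nu}}^*T_{\boldsymbol{\nu}}$ have the same eigenvalues. (ii) For $\lambda\neq0$, a function $u\in L^2(\Gamma_1,\sigma)$ is an eigenfunction of $T_{\boldsymbol{\nu}}^*T_{\boldsymbol{\nu}}$ with eigenvalue $\lambda$ if and only if there is an eigenvector $\mathbf{u}\in\mathbb{R}^{M_D}$ of $\boldsymbol{\Lambda}^{\boldsymbol{\nu}}$ with eigenvalue $\lambda$ such that $$u=T_{\boldsymbol{\nu}}^*\mathbf{u}=\sum_{i=1}^{M_D}\nu_i[\mathbf{u}]_i\,\rho_{\mathbf{x}_i^D}\quad\text{on }\Gamma_1 .$$ (iii) Let $k:=\dim\big(\operatorname{Ker}\boldsymbol{\Lambda}^{\boldsymbol{\nu}}\big)^{\perp}\le M_D$ and let $\{\mathbf{u}_1,\dots,\mathbf{u}_k\}$ be an orthonormal basis of $(\operatorname{Ker}\boldsymbol{\Lambda}^{\boldsymbol{\nu}})^\perp\subset\mathbb{R}^{M_D}$ consisting of eigenvectors of $\boldsymbol{\Lambda}^{\boldsymbol{\nu}}$ with corresponding eigenvalues $\lambda_1\ge\lambda_2\ge\dots\ge\lambda_k>0$. Define $$u_j:=\lambda_j^{-1/2}T_{\boldsymbol{\nu}}^*\mathbf{u}_j=\lambda_j^{-1/2}\sum_{i=1}^{M_D}\nu_i[\mathbf{u}_j]_i\,\rho_{\mathbf{x}^D_i},\qquad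 j=1,\dots,k.$$ Then $\{u_1,\dots,u_k\}$ is an orthonormal basis of $\big(\operatorname{Ker}(T_{\boldsymbol{\nu}}^*T_{\boldsymbol{\nu}})\big)^\perp\subset L^2(\Gamma_1,\sigma)$ consisting of eigenfunctions of $T_{\boldsymbol{\nu}}^*T_{\boldsymbol{\nu}}$. In particular, $\dim(\operatorname{Ker}\boldsymbol{\Lambda}^{\boldsymbol{\nu}})^\perp=\dim\big(\operatorname{Ker}(T_{\boldsymbol{\nu}}^*T_{\boldsymbol{\nu}})\big)^\perp$.
   Context: A domain is a nonempty connected open set. Strict ellipticity of $\mathbf{K}$ means that there is $\lambda_0>0$ with $\xi\cdot\mathbf{K}(\mathbf{x})\xi\ge\lambda_0|\xi|^2$ for all $\mathbf{x}\in D$, $\xi\in\mathbb{R}^d$. Elliptic measure: a local solution of $\operatorname{div}(\mathbf{K}\nabla u)=0$ in $D$ is a function $u\in H^1_{loc}(D)$ (taken continuous) with $\int_D\nabla u\cdot(\mathbf{K}\nabla\varphi)\,d\mathbf{x}=0$ for all $\varphi\in C_c^1(D)$. For every $f\in C(\partial D)$ let $u_f$ be the unique solution of the Dirichlet problem with data $f$, i.e. the local solution with $\lim_{\mathbf{x}\to\mathbf{y},\,\mathbf{x}\in D}u_f(\mathbf{x})=f(\mathbf{y})$ at every regular boundary point $\mathbf{y}$ (regular for the Dirichlet problem); $\mu_{\mathbf{x}}$ is the unique probability measure on $\partial D$ with $u_f(\mathbf{x})=\int_{\partial D} f\,d\mu_{\mathbf{x}}$ for all $f\in C(\partial D)$.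 $[\mathbf{u}]_i$ denotes the $i$-th component of the vector $\mathbf{u}$. Eigenvectors and eigenfunctions are nonzero. The matrix $\boldsymbol{\Lambda}^{\boldsymbol{\nu}}$ is identified with the operator it induces on $\mathbb{R}^{M_D}$.
   Formalization: Item (i) is stated for nonzero eigenvalues only: with linearly independent densities and infinite-dimensional L²(Γ₁), 0 is an eigenvalue of T*T but not of Λ. The Dirichlet solution u_f is required to be bounded, as its uniqueness needs. *)

theory Defs
  imports "HOL-Analysis.Analysis" "HOL-Probability.Probability_Measure"
begin

section \<open>Hausdorff measure\<close>

text \<open>
  The library diameter of an unbounded set is a junk value, so covering sets are required to be
  bounded. The empty set costs nothing, also for s = 0. The constant normalises the measure so
  that in dimension s it agrees with Lebesgue measure (hence with surface area).
\<close>

definition hausdorff_pre :: "nat \<Rightarrow> real \<Rightarrow> 'a::metric_space set \<Rightarrow> ennreal" where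
  "hausdorff_pre s \<delta> A =
     (INF U\<in>{U :: nat \<Rightarrow> 'a set. A \<subseteq> (\<Union>i. U i) \<and> (\<forall>i. bounded (U i) \<and> diameter (U i) \<le> \<delta>)}.
        \<Sum>i. ennreal (if U i = {} then 0 else unit_ball_vol (real s) * (diameter (U i) / 2) ^ s))"

definition hausdorff_outer :: "nat \<Rightarrow> 'a::metric_space set \<Rightarrow> ennreal" where
  "hausdorff_outer s A = (SUP \<delta>\<in>{0<..}. hausdorff_pre s \<delta> A)"

text \<open>
  The outer measure above is a metric outer measure, hence countably additive on Borel sets.
\<close>

definition hausdorff_measure :: "nat \<Rightarrow> 'a::metric_space measure" where
  "hausdorff_measure s = measure_of UNIV (sets borel) (hausdorff_outer s)"

definition boundary_measure :: "'a::euclidean_space set \<Rightarrow> 'a measure" where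
  "boundary_measure D = restrict_space (hausdorff_measure (DIM('a) - 1)) (frontier D)"


section \<open>Elliptic equations in divergence form\<close>

definition strictly_elliptic :: "(real^'n) set \<Rightarrow> (real^'n \<Rightarrow> real^'n^'n) \<Rightarrow> bool" where
  "strictly_elliptic D K \<longleftrightarrow>
     (\<exists>c>0. \<forall>x\<in>D. \<forall>\<xi>. \<xi> \<bullet> (K x *v \<xi>) \<ge> c * (norm \<xi>)\<^sup>2)"

definition C1_gradient :: "('a::euclidean_space \<Rightarrow> real) \<Rightarrow> ('a \<Rightarrow> 'a) \<Rightarrow> bool" where
  "C1_gradient h h' \<longleftrightarrow> (\<forall>x. GDERIV h x :> h' x) \<and> continuous_on UNIV h'"

text \<open>Functions in the class of compactly supported C1 functions on D are extended by zero.\<close>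

definition test_function :: "'a::euclidean_space set \<Rightarrow> ('a \<Rightarrow> real) \<Rightarrow> ('a \<Rightarrow> 'a) \<Rightarrow> bool" where
  "test_function D \<phi> \<phi>' \<longleftrightarrow>
     C1_gradient \<phi> \<phi>' \<and> compact (closure {x. \<phi> x \<noteq> 0}) \<and> closure {x. \<phi> x \<noteq> 0} \<subseteq> D"

definition L2_loc :: "'a::euclidean_space set \<Rightarrow> ('a \<Rightarrow> 'b::euclidean_space) \<Rightarrow> bool" where
  "L2_loc D f \<longleftrightarrow> f \<in> borel_measurable (lebesgue_on D) \<and>
     (\<forall>C. compact C \<and> C \<subseteq> D \<longrightarrow> integrable (lebesgue_on C) (\<lambda>x. (norm (f x))\<^sup>2))"

text \<open>The function u lies in the local Sobolev space of D and has weak gradient g there.\<close>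

definition H1_loc_gradient :: "'a::euclidean_space set \<Rightarrow> ('a \<Rightarrow> real) \<Rightarrow> ('a \<Rightarrow> 'a) \<Rightarrow> bool" where
  "H1_loc_gradient D u g \<longleftrightarrow> L2_loc D u \<and> L2_loc D g \<and>
     (\<forall>\<phi> \<phi>'. test_function D \<phi> \<phi>' \<longrightarrow>
        (LINT x|lebesgue_on D. u x *\<^sub>R \<phi>' x) = - (LINT x|lebesgue_on D. \<phi> x *\<^sub>R g x))"

definition local_solution_gradient ::
  "(real^'n \<Rightarrow> real^'n^'n) \<Rightarrow> (real^'n) set \<Rightarrow> (real^'n \<Rightarrow> real) \<Rightarrow> (real^'n \<Rightarrow> real^'n) \<Rightarrow> bool" where
  "local_solution_gradient K D u g \<longleftrightarrow> continuous_on D u \<and> H1_loc_gradient D u g \<and>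
     (\<forall>\<phi> \<phi>'. test_function D \<phi> \<phi>' \<longrightarrow> (LINT x|lebesgue_on D. g x \<bullet> (K x *v \<phi>' x)) = 0)"

definition local_solution ::
  "(real^'n \<Rightarrow> real^'n^'n) \<Rightarrow> (real^'n) set \<Rightarrow> (real^'n \<Rightarrow> real) \<Rightarrow> bool" where
  "local_solution K D u \<longleftrightarrow> (\<exists>g. local_solution_gradient K D u g)"

text \<open>
  The zero-boundary-value Sobolev space as the closure of the test functions in the H1 norm.
  Nonnegative integrals are used so that non-integrability cannot be mistaken for the value 0.
\<close>

definition H1_zero_gradient :: "'a::euclidean_space set \<Rightarrow> ('a \<Rightarrow> real) \<Rightarrow> ('a \<Rightarrow> 'a) \<Rightarrow> bool" where
  "H1_zero_gradient D w g \<longleftrightarrow>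
     w \<in> borel_measurable (lebesgue_on D) \<and> g \<in> borel_measurable (lebesgue_on D) \<and>
     (\<exists>\<phi> \<phi>'. (\<forall>n::nat. test_function D (\<phi> n) (\<phi>' n)) \<and>
       (\<lambda>n. \<integral>\<^sup>+x. ennreal ((\<phi> n x - w x)\<^sup>2) \<partial>lebesgue_on D) \<longlonglongrightarrow> 0 \<and>
       (\<lambda>n. \<integral>\<^sup>+x. ennreal ((norm (\<phi>' n x - g x))\<^sup>2) \<partial>lebesgue_on D) \<longlonglongrightarrow> 0)"

text \<open>
  The solution whose boundary values are those of the C1 function h in the Sobolev sense.
\<close>

definition variational_solution ::
  "(real^'n \<Rightarrow> real^'n^'n) \<Rightarrow> (real^'n) set \<Rightarrow> (real^'n \<Rightarrow> real) \<Rightarrow> (real^'n \<Rightarrow> real) \<Rightarrow> bool" where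
  "variational_solution K D h u \<longleftrightarrow> (\<exists>g h'. C1_gradient h h' \<and> local_solution_gradient K D u g \<and>
     H1_zero_gradient D (\<lambda>x. u x - h x) (\<lambda>x. g x - h' x))"

text \<open>
  Regular boundary points in the sense of Littman, Stampacchia and Weinberger. Restrictions of
  C1 functions are uniformly dense in the continuous functions on the compact boundary, so by the
  maximum principle C1 data suffice.
\<close>

definition regular_boundary_point ::
  "(real^'n \<Rightarrow> real^'n^'n) \<Rightarrow> (real^'n) set \<Rightarrow> real^'n \<Rightarrow> bool" where
  "regular_boundary_point K D y \<longleftrightarrow> y \<in> frontier D \<and>
     (\<forall>h u. variational_solution K D h u \<longrightarrow> (u \<longlongrightarrow> h y) (at y within D))"

text \<open>
  Boundedness is what makes the solution unique: on the punctured unit disc the logarithm of |x|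
  is harmonic and vanishes at every regular boundary point.
\<close>

definition dirichlet_solution ::
  "(real^'n \<Rightarrow> real^'n^'n) \<Rightarrow> (real^'n) set \<Rightarrow> (real^'n \<Rightarrow> real) \<Rightarrow> (real^'n \<Rightarrow> real) \<Rightarrow> bool" where
  "dirichlet_solution K D f u \<longleftrightarrow> local_solution K D u \<and> bounded (u ` D) \<and>
     (\<forall>y. regular_boundary_point K D y \<longrightarrow> (u \<longlongrightarrow> f y) (at y within D))"

definition is_elliptic_measure ::
  "(real^'n \<Rightarrow> real^'n^'n) \<Rightarrow> (real^'n) set \<Rightarrow> real^'n \<Rightarrow> (real^'n) measure \<Rightarrow> bool" where
  "is_elliptic_measure K D x \<mu> \<longleftrightarrow>
     prob_space \<mu> \<and> sets \<mu> = sets (restrict_space borel (frontier D)) \<and>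
     (\<forall>f. continuous_on (frontier D) f \<longrightarrow>
        (\<exists>u. dirichlet_solution K D f u \<and> u x = (LINT y|\<mu>. f y)))"


section \<open>Square-integrable functions\<close>

text \<open>
  Elements of L2 are represented by functions. Equality in L2 is equality almost everywhere, and
  all notions below are invariant under it.
\<close>

definition L2 :: "'a measure \<Rightarrow> ('a \<Rightarrow> real) set" where
  "L2 M = {f \<in> borel_measurable M. integrable M (\<lambda>y. (f y)\<^sup>2)}"

definition L2_inner :: "'a measure \<Rightarrow> ('a \<Rightarrow> real) \<Rightarrow> ('a \<Rightarrow> real) \<Rightarrow> real" where
  "L2_inner M f g = (LINT y|M. f y * g y)"

definition L2_orthogonal_comp :: "'a measure \<Rightarrow> ('a \<Rightarrow> real) set \<Rightarrow> ('a \<Rightarrow> real) set" where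
  "L2_orthogonal_comp M W = {f \<in> L2 M. \<forall>g\<in>W. L2_inner M g f = 0}"

definition L2_kernel :: "'a measure \<Rightarrow> (('a \<Rightarrow> real) \<Rightarrow> 'a \<Rightarrow> real) \<Rightarrow> ('a \<Rightarrow> real) set" where
  "L2_kernel M A = {f \<in> L2 M. AE y in M. A f y = 0}"

definition L2_eigenfunction ::
  "'a measure \<Rightarrow> (('a \<Rightarrow> real) \<Rightarrow> 'a \<Rightarrow> real) \<Rightarrow> real \<Rightarrow> ('a \<Rightarrow> real) \<Rightarrow> bool" where
  "L2_eigenfunction M A l f \<longleftrightarrow>
     f \<in> L2 M \<and> \<not> (AE y in M. f y = 0) \<and> (AE y in M. A f y = l * f y)"

definition L2_spans :: "'a measure \<Rightarrow> ('a \<Rightarrow> real) set \<Rightarrow> nat \<Rightarrow> (nat \<Rightarrow> 'a \<Rightarrow> real) \<Rightarrow> bool" where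
  "L2_spans M V k b \<longleftrightarrow>
     (\<forall>j<k. b j \<in> V) \<and> (\<forall>f\<in>V. \<exists>c. AE y in M. f y = (\<Sum>j<k. c j * b j y))"

definition L2_basis :: "'a measure \<Rightarrow> ('a \<Rightarrow> real) set \<Rightarrow> nat \<Rightarrow> (nat \<Rightarrow> 'a \<Rightarrow> real) \<Rightarrow> bool" where
  "L2_basis M V k b \<longleftrightarrow> L2_spans M V k b \<and>
     (\<forall>c. (AE y in M. (\<Sum>j<k. c j * b j y) = 0) \<longrightarrow> (\<forall>j<k. c j = 0))"

definition L2_orthonormal_basis ::
  "'a measure \<Rightarrow> ('a \<Rightarrow> real) set \<Rightarrow> nat \<Rightarrow> (nat \<Rightarrow> 'a \<Rightarrow> real) \<Rightarrow> bool" where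
  "L2_orthonormal_basis M V k b \<longleftrightarrow> L2_spans M V k b \<and>
     (\<forall>i<k. \<forall>j<k. L2_inner M (b i) (b j) = (if i = j then 1 else 0))"

definition L2_has_dim :: "'a measure \<Rightarrow> ('a \<Rightarrow> real) set \<Rightarrow> nat \<Rightarrow> bool" where
  "L2_has_dim M V k \<longleftrightarrow> (\<exists>b. L2_basis M V k b)"

text \<open>The Hilbert space adjoint of an operator into a Euclidean space, up to null sets.\<close>

definition is_L2_adjoint ::
  "'a measure \<Rightarrow> (('a \<Rightarrow> real) \<Rightarrow> 'b::euclidean_space) \<Rightarrow> ('b \<Rightarrow> 'a \<Rightarrow> real) \<Rightarrow> bool" where
  "is_L2_adjoint M T S \<longleftrightarrow> (\<forall>v. S v \<in> L2 M \<and> (\<forall>f\<in>L2 M. T f \<bullet> v = L2_inner M f (S v)))"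

definition L2_adjoint ::
  "'a measure \<Rightarrow> (('a \<Rightarrow> real) \<Rightarrow> 'b::euclidean_space) \<Rightarrow> 'b \<Rightarrow> 'a \<Rightarrow> real" where
  "L2_adjoint M T = (SOME S. is_L2_adjoint M T S)"

definition eigenvector :: "real^'m^'m \<Rightarrow> real \<Rightarrow> real^'m \<Rightarrow> bool" where
  "eigenvector A l v \<longleftrightarrow> v \<noteq> 0 \<and> A *v v = l *\<^sub>R v"


section \<open>The operator and the matrix built from the densities\<close>

definition T_op :: "'a measure \<Rightarrow> real^'m \<Rightarrow> ('m \<Rightarrow> 'a \<Rightarrow> real) \<Rightarrow> ('a \<Rightarrow> real) \<Rightarrow> real^'m" where
  "T_op M \<nu> r u = (\<chi> i. \<nu> $ i * (LINT y|M. u y * r i y))"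

definition Lambda_mat :: "'a measure \<Rightarrow> real^'m \<Rightarrow> ('m \<Rightarrow> 'a \<Rightarrow> real) \<Rightarrow> real^'m^'m" where
  "Lambda_mat M \<nu> r = (\<chi> i j. \<nu> $ i * \<nu> $ j * (LINT y|M. r i y * r j y))"

end

theory Submission
  imports Defs
begin

text \<open>
  Everything follows from the adjoint relation of T and its adjoint T'. The kernel of T' T is the
  kernel of T, since the inner product of u with T' T u is the squared norm of T u; likewise
  the kernel of T T' is the kernel of T'. Hence T f is orthogonal to the kernel of the
  self-adjoint operator T T', that is, T f = T T' v for some v orthogonal to this kernel. If f is
  orthogonal to the kernel of T, then so is f - T' v, which moreover lies in this kernel;
  therefore f = T' v.
\<close>

section \<open>Square-integrable functions\<close>

lemma L2_measurable: "f \<in> L2 M \<Longrightarrow> f \<in> borel_measurable M"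
  by (simp add: L2_def)

text \<open>The product is dominated by the sum of the squares. Inner products of \<open>L2\<close>
  functions are thus genuine integrals and not the default value 0 of a non-integrable
  function.\<close>

lemma L2_integrable_mult:
  assumes "f \<in> L2 M" "g \<in> L2 M"
  shows "integrable M (\<lambda>y. f y * g y)"
proof (rule Bochner_Integration.integrable_bound)
  show "integrable M (\<lambda>y. (f y)\<^sup>2 + (g y)\<^sup>2)"
    using assms by (simp add: L2_def)
  show "(\<lambda>y. f y * g y) \<in> borel_measurable M"
    using assms[THEN L2_measurable] by measurable
  have "\<bar>a * b\<bar> \<le> a\<^sup>2 + b\<^sup>2" for a b :: real
  proof -
    have "2 * (\<bar>a\<bar> * \<bar>b\<bar>) \<le> \<bar>a\<bar>\<^sup>2 + \<bar>b\<bar>\<^sup>2"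
      using sum_squares_bound[of "\<bar>a\<bar>" "\<bar>b\<bar>"] by (simp add: mult.assoc)
    moreover have "0 \<le> \<bar>a\<bar> * \<bar>b\<bar>" by simp
    ultimately show ?thesis by (simp only: abs_mult power2_abs)
  qed
  then show "AE y in M. norm (f y * g y) \<le> norm ((f y)\<^sup>2 + (g y)\<^sup>2)"
    by (intro AE_I2) (simp add: order_trans[OF _ abs_ge_self])
qed

lemma L2_zero [simp]: "(\<lambda>y. 0) \<in> L2 M"
  by (simp add: L2_def)

lemma L2_scale: "f \<in> L2 M \<Longrightarrow> (\<lambda>y. c * f y) \<in> L2 M"
  by (auto simp: L2_def power_mult_distrib)

lemma L2_add:
  assumes "f \<in> L2 M" "g \<in> L2 M"
  shows "(\<lambda>y. f y + g y) \<in> L2 M"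
  using assms L2_integrable_mult[OF assms]
  by (auto simp: L2_def power2_sum mult.assoc)

lemma L2_diff:
  assumes "f \<in> L2 M" "g \<in> L2 M"
  shows "(\<lambda>y. f y - g y) \<in> L2 M"
  using L2_add[OF assms(1) L2_scale[OF assms(2), of "-1"]] by simp

lemma L2_sum:
  assumes "\<And>i. i \<in> I \<Longrightarrow> f i \<in> L2 M"
  shows "(\<lambda>y. \<Sum>i\<in>I. f i y) \<in> L2 M"
  using assms by (induction I rule: infinite_finite_induct) (auto intro: L2_add)

lemma L2_restrict_space:
  assumes "f \<in> L2 M" "\<Omega> \<inter> space M \<in> sets M"
  shows "f \<in> L2 (restrict_space M \<Omega>)"
proof -
  have "integrable M (\<lambda>y. (f y)\<^sup>2)" "f \<in> borel_measurable M"
    using assms by (auto simp: L2_def)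
  then have "integrable M (\<lambda>y. indicator (\<Omega> \<inter> space M) y *\<^sub>R (f y)\<^sup>2)"
    using assms(2) by (intro integrable_mult_indicator)
  \<comment> \<open>The restriction rule uses the indicator of \<Omega> alone; both indicators agree
    on \<open>space M\<close>.\<close>
  also have "?this \<longleftrightarrow> integrable M (\<lambda>y. indicator \<Omega> y *\<^sub>R (f y)\<^sup>2)"
    by (rule Bochner_Integration.integrable_cong) (auto simp: indicator_def)
  finally have "integrable (restrict_space M \<Omega>) (\<lambda>y. (f y)\<^sup>2)"
    by (simp add: integrable_restrict_space assms(2))
  then show ?thesis
    using \<open>f \<in> borel_measurable M\<close> by (simp add: L2_def measurable_restrict_space1)
qed

section \<open>The inner product and equality almost everywhere\<close>

lemma L2_inner_commute: "L2_inner M f g = L2_inner M g f"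
  by (simp add: L2_inner_def mult.commute)

lemma L2_inner_scale_right: "L2_inner M f (\<lambda>y. c * g y) = c * L2_inner M f g"
  by (simp add: L2_inner_def mult.left_commute)

lemma L2_inner_scale_left: "L2_inner M (\<lambda>y. c * f y) g = c * L2_inner M f g"
  by (simp add: L2_inner_def mult.assoc)

lemma L2_inner_sum_right:
  assumes "f \<in> L2 M" "\<And>i. i \<in> I \<Longrightarrow> g i \<in> L2 M"
  shows "L2_inner M f (\<lambda>y. \<Sum>i\<in>I. g i y) = (\<Sum>i\<in>I. L2_inner M f (g i))"
  using assms
  by (simp add: L2_inner_def sum_distrib_left L2_integrable_mult Bochner_Integration.integral_sum)

lemma L2_inner_diff_right:
  assumes "f \<in> L2 M" "g \<in> L2 M" "h \<in> L2 M"
  shows "L2_inner M f (\<lambda>y. g y - h y) = L2_inner M f g - L2_inner M f h"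
  using assms by (simp add: L2_inner_def right_diff_distrib L2_integrable_mult)

lemma L2_inner_diff_left:
  assumes "f \<in> L2 M" "g \<in> L2 M" "h \<in> L2 M"
  shows "L2_inner M (\<lambda>y. g y - h y) f = L2_inner M g f - L2_inner M h f"
  using L2_inner_diff_right[OF assms] by (simp add: L2_inner_commute)

lemma L2_inner_cong_AE:
  assumes "f \<in> L2 M" "f' \<in> L2 M" "g \<in> L2 M" "g' \<in> L2 M"
    and "AE y in M. f y = f' y" "AE y in M. g y = g' y"
  shows "L2_inner M f g = L2_inner M f' g'"
  unfolding L2_inner_def
proof (rule integral_cong_AE)
  show "AE y in M. f y * g y = f' y * g' y"
    using assms(5,6) by eventually_elim simp
qed (use assms in \<open>auto simp: L2_def\<close>)

lemma L2_inner_self_eq_0: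
  assumes "f \<in> L2 M"
  shows "L2_inner M f f = 0 \<longleftrightarrow> (AE y in M. f y = 0)"
  using integral_nonneg_eq_0_iff_AE[of M "\<lambda>y. f y * f y"] L2_integrable_mult[OF assms assms]
  by (simp add: L2_inner_def)

lemma L2_inner_self_nonneg: "0 \<le> L2_inner M f f"
  by (simp add: L2_inner_def)

text \<open>Testing with \<open>h = f - g\<close> makes the difference orthogonal to itself. The
  almost-everywhere identities for the adjoint rest on this.\<close>

lemma L2_AE_eqI:
  assumes "f \<in> L2 M" "g \<in> L2 M" "\<And>h. h \<in> L2 M \<Longrightarrow> L2_inner M h f = L2_inner M h g"
  shows "AE y in M. f y = g y"
proof -
  let ?d = "\<lambda>y. f y - g y"
  have d: "?d \<in> L2 M" using assms(1,2) by (rule L2_diff)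
  have "L2_inner M ?d ?d = 0"
    using assms d by (simp add: L2_inner_diff_right)
  then show ?thesis using d by (simp add: L2_inner_self_eq_0)
qed

text \<open>\<open>A\<close> is an arbitrary map on functions, so agreement of \<open>A f\<close>
  and \<open>A g\<close> up to null sets has to be assumed.\<close>

lemma L2_eigenfunction_cong_AE:
  assumes "f \<in> L2 M" "L2_eigenfunction M A l g" "AE y in M. f y = g y"
    and "AE y in M. A f y = A g y"
  shows "L2_eigenfunction M A l f"
proof -
  have "\<not> (AE y in M. f y = 0)"
  proof
    assume "AE y in M. f y = 0"
    with assms(3) have "AE y in M. g y = 0" by eventually_elim simp
    then show False using assms(2) by (simp add: L2_eigenfunction_def)
  qed
  moreover have "AE y in M. A g y = l * g y" using assms(2) by (simp add: L2_eigenfunction_def)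
  then have "AE y in M. A f y = l * f y"
    using assms(3,4) by eventually_elim simp
  ultimately show ?thesis using assms(1) by (simp add: L2_eigenfunction_def)
qed


section \<open>Adjoint pairs\<close>

lemma span_image_obtain:
  fixes e :: "'i \<Rightarrow> 'b::real_vector"
  assumes "v \<in> span (e ` I)" "finite I"
  obtains c where "v = (\<Sum>i\<in>I. c i *\<^sub>R e i)"
proof -
  have "\<exists>c. v = (\<Sum>i\<in>I. c i *\<^sub>R e i)"
    using assms(1)
  proof (induction rule: span_induct_alt)
    case base
    show ?case by (intro exI[of _ "\<lambda>_. 0"]) simp
  next
    case (step a x w)
    then obtain i c where "i \<in> I" "x = e i" "w = (\<Sum>i\<in>I. c i *\<^sub>R e i)" by auto
    \<comment> \<open>The new term changes only the coefficient at the index \<open>i\<close>, so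
      \<open>e\<close> may repeat vectors.\<close>
    then show ?case
      using assms(2)
      by (intro exI[of _ "\<lambda>j. (if j = i then a else 0) + c j"])
        (simp add: scaleR_add_left sum.distrib if_distrib[of "\<lambda>t. t *\<^sub>R _"] sum.delta cong: if_cong)
  qed
  then show ?thesis using that by blast
qed

text \<open>The kernel is the orthogonal complement of the range, and in finite dimension taking the
  complement twice returns the subspace.\<close>

lemma self_adjoint_range:
  fixes f :: "'b::euclidean_space \<Rightarrow> 'b"
  assumes "linear f" "\<And>v w. f v \<bullet> w = v \<bullet> f w"
  shows "range f = orthogonal_comp {v. f v = 0}"
proof -
  have "adjoint f = f" using assms(2) by (intro adjoint_unique) simp
  then have "f -` {0} = orthogonal_comp (range f)"
    using ker_orthogonal_comp_adjoint[OF assms(1)] by simp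
  moreover have "orthogonal_comp (orthogonal_comp (range f)) = range f"
    using assms(1) by (intro orthogonal_comp_self linear_subspace_image subspace_UNIV)
  ultimately show ?thesis by (simp add: vimage_def)
qed

text \<open>The adjoint identity alone makes \<open>T\<close> linear on \<open>L2 M\<close>. The
  values of \<open>T'\<close> are representatives of classes, so \<open>T'\<close> is linear only up
  to null sets.\<close>

locale L2_adjoint_pair =
  fixes M :: "'a measure" and T :: "('a \<Rightarrow> real) \<Rightarrow> 'b::euclidean_space"
    and T' :: "'b \<Rightarrow> 'a \<Rightarrow> real"
  assumes is_adjoint: "is_L2_adjoint M T T'"
begin

lemma adjoint_L2 [simp]: "T' v \<in> L2 M"
  using is_adjoint by (simp add: is_L2_adjoint_def)

lemma adjoint_inner: "f \<in> L2 M \<Longrightarrow> T f \<bullet> v = L2_inner M f (T' v)"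
  using is_adjoint by (simp add: is_L2_adjoint_def)

section \<open>Uniqueness of the adjoint and linearity of both operators\<close>

lemma adjoint_unique_AE:
  assumes "is_L2_adjoint M T R"
  shows "AE y in M. T' v y = R v y"
  using assms by (intro L2_AE_eqI) (auto simp: is_L2_adjoint_def adjoint_inner[symmetric])

lemma T_cong_AE:
  assumes "f \<in> L2 M" "g \<in> L2 M" "AE y in M. f y = g y"
  shows "T f = T g"
proof (rule vector_eq_rdot[THEN iffD1], intro allI)
  fix v show "T f \<bullet> v = T g \<bullet> v"
    using assms L2_inner_cong_AE[OF assms(1,2) adjoint_L2 adjoint_L2 assms(3)]
    by (simp add: adjoint_inner)
qed

lemma T_scale: "f \<in> L2 M \<Longrightarrow> T (\<lambda>y. c * f y) = c *\<^sub>R T f"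
  by (rule vector_eq_rdot[THEN iffD1])
    (simp add: adjoint_inner L2_scale L2_inner_scale_left)

lemma T_diff: "f \<in> L2 M \<Longrightarrow> g \<in> L2 M \<Longrightarrow> T (\<lambda>y. f y - g y) = T f - T g"
  by (rule vector_eq_rdot[THEN iffD1])
    (simp add: adjoint_inner L2_diff L2_inner_diff_left inner_diff_left)

lemma T_zero: "T (\<lambda>y. 0) = 0"
  using T_scale[of "\<lambda>y. 0" 0] by simp

lemma adjoint_sum: "AE y in M. T' (\<Sum>i\<in>I. c i *\<^sub>R v i) y = (\<Sum>i\<in>I. c i * T' (v i) y)"
  by (rule L2_AE_eqI)
    (simp_all add: L2_sum L2_scale L2_inner_sum_right L2_inner_scale_right inner_sum_right
      flip: adjoint_inner)

lemma adjoint_scale: "AE y in M. T' (c *\<^sub>R v) y = c * T' v y"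
  using adjoint_sum[of "\<lambda>_. c" "\<lambda>_. v" "{()}"] by simp

lemma adjoint_zero: "AE y in M. T' 0 y = 0"
  using adjoint_scale[of 0 0] by simp

section \<open>The self-adjoint operator \<open>T T'\<close>\<close>

lemma T_adjoint_inner: "T (T' v) \<bullet> w = L2_inner M (T' v) (T' w)"
  by (simp add: adjoint_inner)

lemma T_adjoint_self_adjoint: "T (T' v) \<bullet> w = v \<bullet> T (T' w)"
  by (metis T_adjoint_inner L2_inner_commute inner_commute)

text \<open>Moving a self-adjoint map across the inner product reduces its linearity to that of the
  inner product. This gives exact linearity, although \<open>T'\<close> itself is linear only almost
  everywhere.\<close>

lemma T_adjoint_linear: "linear (\<lambda>v. T (T' v))"
  by (rule linearI; rule vector_eq_rdot[THEN iffD1])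
    (simp_all add: T_adjoint_self_adjoint inner_add_left)

text \<open>The inner product of \<open>T (T' v)\<close> with \<open>v\<close> is the squared norm
  of \<open>T' v\<close>.\<close>

lemma T_adjoint_eq_0: "T (T' v) = 0 \<longleftrightarrow> (AE y in M. T' v y = 0)"
proof
  assume "T (T' v) = 0"
  then show "AE y in M. T' v y = 0"
    using T_adjoint_inner[of v v] by (simp add: L2_inner_self_eq_0)
next
  assume "AE y in M. T' v y = 0"
  then show "T (T' v) = 0" using T_cong_AE[of "T' v" "\<lambda>y. 0"] by (simp add: T_zero)
qed

section \<open>Eigenvalues and eigenfunctions of \<open>T' T\<close>\<close>

lemma eigenfunction_adjoint:
  assumes "l \<noteq> 0" "v \<noteq> 0" "T (T' v) = l *\<^sub>R v"
  shows "L2_eigenfunction M (\<lambda>u. T' (T u)) l (T' v)"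
  \<comment> \<open>If \<open>T' v\<close> vanished almost everywhere, then so would
    \<open>T (T' v)\<close>, a nonzero multiple of \<open>v\<close>.\<close>
  using assms adjoint_scale[of l v] T_adjoint_eq_0[of v] by (auto simp: L2_eigenfunction_def)

lemma eigenfunction_iff:
  assumes "l \<noteq> 0" "u \<in> L2 M"
  shows "L2_eigenfunction M (\<lambda>u. T' (T u)) l u \<longleftrightarrow>
    (\<exists>v. v \<noteq> 0 \<and> T (T' v) = l *\<^sub>R v \<and> (AE y in M. u y = T' v y))"
proof
  assume u: "L2_eigenfunction M (\<lambda>u. T' (T u)) l u"
  \<comment> \<open>The choice is forced: applying \<open>T\<close> to \<open>u = T' v\<close> gives
    \<open>T u = T (T' v)\<close>, which must be \<open>l\<close> times \<open>v\<close>.\<close>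
  let ?v = "(1 / l) *\<^sub>R T u"
  have eq: "AE y in M. T' (T u) y = l * u y"
    using u by (simp add: L2_eigenfunction_def)
  then have uv: "AE y in M. u y = T' ?v y"
    using adjoint_scale[of "1 / l" "T u"] by eventually_elim (use assms(1) in simp)
  have "T (T' ?v) = T u"
    using uv assms(2) T_cong_AE[of u "T' ?v"] by simp
  then have "T (T' ?v) = l *\<^sub>R ?v" using assms(1) by simp
  moreover have "?v \<noteq> 0"
  proof
    assume "?v = 0"
    with uv have "AE y in M. u y = T' 0 y" by simp
    with adjoint_zero have "AE y in M. u y = 0" by eventually_elim simp
    then show False using u by (simp add: L2_eigenfunction_def)
  qed
  ultimately show "\<exists>v. v \<noteq> 0 \<and> T (T' v) = l *\<^sub>R v \<and> (AE y in M. u y = T' v y)"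
    using uv by blast
next
  assume "\<exists>v. v \<noteq> 0 \<and> T (T' v) = l *\<^sub>R v \<and> (AE y in M. u y = T' v y)"
  then obtain v where v: "v \<noteq> 0" "T (T' v) = l *\<^sub>R v" and uv: "AE y in M. u y = T' v y" by blast
  have "T u = T (T' v)" using uv assms(2) by (intro T_cong_AE) auto
  then show "L2_eigenfunction M (\<lambda>u. T' (T u)) l u"
    using eigenfunction_adjoint[OF assms(1) v] assms(2) uv by (auto intro: L2_eigenfunction_cong_AE)
qed

text \<open>At \<open>l = 0\<close> the two sides can differ: if \<open>L2 M\<close> is
  infinite-dimensional, \<open>T' T\<close> always has a nontrivial kernel, whereas
  \<open>T T'\<close> may be injective.\<close>

lemma eigenvalue_iff:
  assumes "l \<noteq> 0"
  shows "(\<exists>v. v \<noteq> 0 \<and> T (T' v) = l *\<^sub>R v) \<longleftrightarrow> (\<exists>u. L2_eigenfunction M (\<lambda>u. T' (T u)) l u)"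
  using assms eigenfunction_adjoint eigenfunction_iff L2_eigenfunction_def by metis

section \<open>Kernels, their orthogonal complements and bases\<close>

lemma L2_kernel_adjoint_T: "L2_kernel M (\<lambda>u. T' (T u)) = {u \<in> L2 M. T u = 0}"
proof -
  have "T u = 0" if "u \<in> L2 M" "AE y in M. T' (T u) y = 0" for u
  proof -
    have "T u \<bullet> T u = L2_inner M u (\<lambda>y. 0)"
      using that by (simp add: adjoint_inner L2_inner_cong_AE)
    then show ?thesis by (simp add: L2_inner_def)
  qed
  then show ?thesis using adjoint_zero by (auto simp: L2_kernel_def)
qed

lemma adjoint_in_orthogonal_comp:
  "T' v \<in> L2_orthogonal_comp M (L2_kernel M (\<lambda>u. T' (T u)))"
  by (simp add: L2_orthogonal_comp_def L2_kernel_adjoint_T flip: adjoint_inner)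

text \<open>Placing \<open>v\<close> in the complement of the kernel of \<open>T T'\<close> allows
  it to be expanded later in a basis of that complement.\<close>

lemma orthogonal_comp_kernel_obtain:
  assumes "f \<in> L2_orthogonal_comp M (L2_kernel M (\<lambda>u. T' (T u)))"
  obtains v where "v \<in> orthogonal_comp {v. T (T' v) = 0}" "AE y in M. f y = T' v y"
proof -
  let ?N = "{v. T (T' v) = 0}"
  have f: "f \<in> L2 M" and orth: "\<And>g. g \<in> L2 M \<Longrightarrow> T g = 0 \<Longrightarrow> L2_inner M g f = 0"
    using assms by (auto simp: L2_orthogonal_comp_def L2_kernel_adjoint_T)
  have range: "range (\<lambda>v. T (T' v)) = orthogonal_comp ?N"
    by (rule self_adjoint_range[OF T_adjoint_linear T_adjoint_self_adjoint])
  have "T f \<bullet> v = 0" if "T (T' v) = 0" for v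
    using that orth[of "T' v"] f by (simp add: adjoint_inner L2_inner_commute)
  then have "T f \<in> orthogonal_comp ?N"
    by (auto simp: orthogonal_comp_def orthogonal_def inner_commute)
  with range obtain v0 where v0: "T f = T (T' v0)" by auto
  have "subspace ?N"
    using linear_subspace_vimage[OF T_adjoint_linear subspace_single_0] by (simp add: vimage_def)
  then have "v0 \<in> ?N + orthogonal_comp ?N"
    by (simp only: subspace_sum_orthogonal_comp UNIV_I)
  then obtain n v where n: "n \<in> ?N" and v: "v \<in> orthogonal_comp ?N" "v0 = n + v"
    by (rule set_plus_elim)
  have "T f = T (T' v)"
    using v0 v n linear_add[OF T_adjoint_linear, of n v] by simp
  moreover let ?d = "\<lambda>y. f y - T' v y"
  have d: "?d \<in> L2 M" using f by (simp add: L2_diff)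
  ultimately have "T ?d = 0" using f by (simp add: T_diff)
  \<comment> \<open>The part with \<open>f\<close> vanishes because \<open>?d\<close> lies in the
    kernel of \<open>T\<close>; the part with \<open>T' v\<close> equals the inner product of
    \<open>T ?d\<close> with \<open>v\<close>.\<close>
  then have "L2_inner M ?d ?d = 0"
    using d f orth[of ?d] adjoint_inner[of ?d v] by (simp add: L2_inner_diff_right)
  then have "AE y in M. f y = T' v y" using d by (simp add: L2_inner_self_eq_0)
  with v show ?thesis using that by blast
qed

text \<open>The weights \<open>a\<close> serve two families: the one normalised by
  \<open>l j powr (-1/2)\<close>, and the unweighted one for the dimension.\<close>

lemma adjoint_spans:
  assumes "span (e ` {..<k}) = orthogonal_comp {v. T (T' v) = 0}" "\<And>j. j < k \<Longrightarrow> a j \<noteq> 0"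
  shows "L2_spans M (L2_orthogonal_comp M (L2_kernel M (\<lambda>u. T' (T u)))) k (\<lambda>j y. a j * T' (e j) y)"
proof -
  let ?V = "L2_orthogonal_comp M (L2_kernel M (\<lambda>u. T' (T u)))"
  have "(\<lambda>y. a j * T' (e j) y) \<in> ?V" for j
    using adjoint_in_orthogonal_comp[of "e j"]
    by (simp add: L2_orthogonal_comp_def L2_scale L2_inner_scale_right)
  moreover have "\<exists>c. AE y in M. f y = (\<Sum>j<k. c j * (a j * T' (e j) y))" if "f \<in> ?V" for f
  proof -
    obtain v where v: "v \<in> orthogonal_comp {v. T (T' v) = 0}" and fv: "AE y in M. f y = T' v y"
      using orthogonal_comp_kernel_obtain[OF \<open>f \<in> ?V\<close>] .
    obtain c where "v = (\<Sum>j<k. c j *\<^sub>R e j)"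
      using v span_image_obtain[of v e "{..<k}"] unfolding assms(1)[symmetric] by blast
    then have "AE y in M. T' v y = (\<Sum>j<k. c j * T' (e j) y)"
      using adjoint_sum by simp
    with fv have "AE y in M. f y = (\<Sum>j<k. c j / a j * (a j * T' (e j) y))"
      by eventually_elim (use assms(2) in \<open>auto intro!: sum.cong\<close>)
    then show ?thesis by (rule exI[of _ "\<lambda>j. c j / a j"])
  qed
  ultimately show ?thesis by (simp add: L2_spans_def)
qed

text \<open>The inner product of \<open>T' (e i)\<close> and \<open>T' (e j)\<close> is
  \<open>l i\<close> times that of \<open>e i\<close> and \<open>e j\<close>. Orthogonality is
  therefore inherited, and the weights restore norm one.\<close>

lemma adjoint_orthonormal_basis:
  assumes orthonormal: "\<And>i j. i < k \<Longrightarrow> j < k \<Longrightarrow> e i \<bullet> e j = (if i = j then 1 else 0)"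
    and span: "span (e ` {..<k}) = orthogonal_comp {v. T (T' v) = 0}"
    and eigen: "\<And>j. j < k \<Longrightarrow> T (T' (e j)) = l j *\<^sub>R e j"
    and pos: "\<And>j. j < k \<Longrightarrow> l j > 0"
  shows "L2_orthonormal_basis M (L2_orthogonal_comp M (L2_kernel M (\<lambda>u. T' (T u)))) k
    (\<lambda>j y. l j powr (-1/2) * T' (e j) y)"
proof -
  have "L2_inner M (\<lambda>y. l i powr (-1/2) * T' (e i) y) (\<lambda>y. l j powr (-1/2) * T' (e j) y) =
      (if i = j then 1 else 0)" if "i < k" "j < k" for i j
  proof -
    have "L2_inner M (T' (e i)) (T' (e j)) = l i * (if i = j then 1 else 0)"
      using eigen orthonormal that by (simp flip: T_adjoint_inner)
    moreover have "l i powr (-1/2) * l i powr (-1/2) = 1 / l i"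
      unfolding powr_add[symmetric] using pos[OF \<open>i < k\<close>] by (simp add: powr_minus_divide)
    ultimately show ?thesis
      using pos[OF \<open>i < k\<close>]
      by (cases "i = j") (simp_all add: L2_inner_scale_left L2_inner_scale_right flip: mult.assoc)
  qed
  moreover have "l j powr (-1/2) \<noteq> 0" if "j < k" for j
    using pos[OF that] by simp
  ultimately show ?thesis
    using adjoint_spans[OF span] by (simp add: L2_orthonormal_basis_def)
qed

text \<open>The squared norm of \<open>T' v\<close> is \<open>l\<close> times that of
  \<open>v\<close>, which excludes negative \<open>l\<close>. For \<open>l = 0\<close> the vector
  would lie both in the kernel and in its complement.\<close>

lemma eigenvalue_pos:
  assumes "T (T' v) = l *\<^sub>R v" "v \<noteq> 0" "v \<in> orthogonal_comp {v. T (T' v) = 0}"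
  shows "l > 0"
proof -
  have "l * (v \<bullet> v) = L2_inner M (T' v) (T' v)"
    using assms(1) by (simp flip: T_adjoint_inner)
  then have "0 \<le> l * (v \<bullet> v)" by (simp add: L2_inner_self_nonneg)
  moreover have "0 < v \<bullet> v" using assms(2) by simp
  ultimately have "0 \<le> l" by (simp only: zero_le_mult_iff) linarith
  moreover have "l \<noteq> 0"
  proof
    assume "l = 0"
    then have "v \<bullet> v = 0"
      using assms(1,3) by (auto simp: orthogonal_comp_def orthogonal_def)
    then show False using assms(2) by simp
  qed
  ultimately show ?thesis by simp
qed

text \<open>Modulo null sets \<open>T'\<close> is injective on the complement, so it carries any
  basis of it to a basis. No diagonalisation enters.\<close>

lemma orthogonal_comp_kernel_dim:
  "L2_has_dim M (L2_orthogonal_comp M (L2_kernel M (\<lambda>u. T' (T u))))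
     (dim (orthogonal_comp {v. T (T' v) = 0}))"
proof -
  let ?W = "orthogonal_comp {v. T (T' v) = 0}"
  have W: "subspace ?W" by (rule subspace_orthogonal_comp)
  obtain B where B: "B \<subseteq> ?W" "independent B" "span B = ?W" "card B = dim ?W"
    using basis_exists[of ?W] W by (metis span_minimal subset_antisym)
  have "finite B" using B(2) by (rule independent_imp_finite)
  \<comment> \<open>\<open>L2_basis\<close> speaks of families indexed by naturals, so the basis set
    is numbered.\<close>
  then obtain e where e: "bij_betw e {..<dim ?W} B"
    using ex_bij_betw_nat_finite[of B] B(4) by (auto simp: atLeast0LessThan)
  then have im: "e ` {..<dim ?W} = B" by (simp add: bij_betw_def)
  have "\<forall>j<dim ?W. c j = 0" if c: "AE y in M. (\<Sum>j<dim ?W. c j * T' (e j) y) = 0" for c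
  proof -
    let ?v = "\<Sum>j<dim ?W. c j *\<^sub>R e j"
    have "AE y in M. T' ?v y = 0" using c adjoint_sum[of c e "{..<dim ?W}"] by eventually_elim simp
    then have "T (T' ?v) = 0" by (simp add: T_adjoint_eq_0)
    moreover have "?v \<in> ?W"
      using im B(1) by (intro subspace_sum[OF W] subspace_scale[OF W]) auto
    ultimately have "?v \<bullet> ?v = 0" by (auto simp: orthogonal_comp_def orthogonal_def)
    then have "?v = 0" by simp
    \<comment> \<open>Independence concerns the set \<open>B\<close>, so the coefficients are
      re-indexed by its elements through the inverse of \<open>e\<close>.\<close>
    then have "(\<Sum>b\<in>B. c (inv_into {..<dim ?W} e b) *\<^sub>R b) = 0"
      using e by (subst sum.reindex_bij_betw[OF e, symmetric])
        (simp add: bij_betw_inv_into_left)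
    then have 0: "c (inv_into {..<dim ?W} e b) = 0" if "b \<in> B" for b
      using B(2) that \<open>finite B\<close> by (auto simp: independent_explicit)
    show ?thesis
    proof (intro allI impI)
      fix j assume "j < dim ?W"
      then have "e j \<in> B" "inv_into {..<dim ?W} e (e j) = j"
        using im bij_betw_inv_into_left[OF e] by auto
      then show "c j = 0" using 0[of "e j"] by simp
    qed
  qed
  moreover have "L2_spans M (L2_orthogonal_comp M (L2_kernel M (\<lambda>u. T' (T u)))) (dim ?W)
      (\<lambda>j. T' (e j))"
    using adjoint_spans[of e "dim ?W" "\<lambda>_. 1"] im B(3) by simp
  ultimately show ?thesis by (auto simp: L2_has_dim_def L2_basis_def)
qed

end


section \<open>The operator and the matrix\<close>

text \<open>Exhibiting one adjoint gives the choice in \<open>L2_adjoint\<close> a meaning; the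
  chosen operator then agrees with this formula up to null sets.\<close>

lemma T_op_is_L2_adjoint:
  assumes r: "\<And>i. r i \<in> L2 M"
  shows "is_L2_adjoint M (T_op M \<nu> r) (\<lambda>v y. \<Sum>i\<in>UNIV. \<nu> $ i * v $ i * r i y)"
  using r
  by (simp add: is_L2_adjoint_def L2_sum L2_scale L2_inner_sum_right L2_inner_scale_right)
    (simp add: T_op_def inner_vec_def L2_inner_def mult_ac)

text \<open>Each component is the inner product of one density with a finite combination of
  densities, expanded by linearity.\<close>

lemma T_op_sum_eq_Lambda_mat:
  assumes r: "\<And>i. r i \<in> L2 M"
  shows "T_op M \<nu> r (\<lambda>y. \<Sum>i\<in>UNIV. \<nu> $ i * v $ i * r i y) = Lambda_mat M \<nu> r *v v"
proof -
  have "L2_inner M (r i) (\<lambda>y. \<Sum>j\<in>UNIV. \<nu> $ j * v $ j * r j y) =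
      (\<Sum>j\<in>UNIV. \<nu> $ j * v $ j * L2_inner M (r i) (r j))" for i
    using r by (simp add: L2_inner_sum_right L2_scale L2_inner_scale_right)
  then show ?thesis
    by (simp add: T_op_def Lambda_mat_def matrix_vector_mult_def vec_eq_iff L2_inner_def
        sum_distrib_left mult_ac)
qed

text \<open>The sets of \<open>measure_of\<close> depend only on the generating family, and the
  Borel sets already form a sigma-algebra. Borel subsets of the boundary are thus measurable for
  \<open>boundary_measure D\<close>.\<close>

lemma sets_boundary_measure: "sets (boundary_measure D) = sets (restrict_space borel (frontier D))"
  unfolding boundary_measure_def
  by (rule sets_restrict_space_cong)
    (simp add: hausdorff_measure_def sets.sigma_sets_eq[of borel, simplified])

theorem proposition3p1:
  fixes D \<Gamma>\<^sub>1 :: "(real^'n) set"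
    and K :: "real^'n \<Rightarrow> real^'n^'n"
    and \<mu> :: "real^'n \<Rightarrow> (real^'n) measure"
    and \<rho> :: "real^'n \<Rightarrow> real^'n \<Rightarrow> real"
    and p :: "'m::finite \<Rightarrow> real^'n"
    and \<nu> :: "real^'m"
  defines "\<sigma> \<equiv> boundary_measure D"
  defines "M \<equiv> restrict_space \<sigma> \<Gamma>\<^sub>1"
  defines "T \<equiv> T_op M \<nu> (\<lambda>i. \<rho> (p i))"
  defines "T' \<equiv> L2_adjoint M T"
  defines "\<Lambda> \<equiv> Lambda_mat M \<nu> (\<lambda>i. \<rho> (p i))"
  defines "S \<equiv> (\<lambda>u. T' (T u))"
  defines "k \<equiv> dim (orthogonal_comp {v. \<Lambda> *v v = 0})"
  assumes "CARD('n) \<ge> 2"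
    and "D \<noteq> {}" and "open D" and "connected D" and "bounded D"
    and "bounded (K ` D)" and "K \<in> borel_measurable (lebesgue_on D)"
    and "\<forall>x\<in>D. transpose (K x) = K x" and "strictly_elliptic D K"
    and "\<Gamma>\<^sub>1 \<subseteq> frontier D" and "\<Gamma>\<^sub>1 \<noteq> {}" and "\<Gamma>\<^sub>1 \<in> sets borel"
    and "\<forall>x\<in>D. is_elliptic_measure K D x (\<mu> x)"
    and "\<forall>x\<in>D. absolutely_continuous \<sigma> (\<mu> x)"
    and "\<forall>x\<in>D. \<rho> x \<in> L2 \<sigma> \<and> (AE y in \<sigma>. 0 \<le> \<rho> x y) \<and>
           \<mu> x = density \<sigma> (\<lambda>y. ennreal (\<rho> x y))"
    and "\<forall>i. p i \<in> D"
    and "\<forall>i. 0 < \<nu> $ i \<and> \<nu> $ i < 1" and "(\<Sum>i\<in>UNIV. (\<nu> $ i)\<^sup>2) = 1"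
  shows "(is_L2_adjoint M T T') \<and>
         (\<forall>v. AE y in M. T' v y = (\<Sum>i\<in>UNIV. \<nu> $ i * v $ i * \<rho> (p i) y)) \<and>
         (\<forall>v. T (T' v) = \<Lambda> *v v) \<and>
         (\<forall>l. l \<noteq> 0 \<longrightarrow> ((\<exists>v. eigenvector \<Lambda> l v) \<longleftrightarrow> (\<exists>u. L2_eigenfunction M S l u))) \<and>
         (\<forall>l. l \<noteq> 0 \<longrightarrow> (\<forall>u\<in>L2 M. L2_eigenfunction M S l u \<longleftrightarrow>
           (\<exists>v. eigenvector \<Lambda> l v \<and> (AE y in M. u y = T' v y) \<and>
                (AE y in M. u y = (\<Sum>i\<in>UNIV. \<nu> $ i * v $ i * \<rho> (p i) y))))) \<and>
         (k \<le> CARD('m)) \<and>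
         (\<forall>(e :: nat \<Rightarrow> real^'m) (l :: nat \<Rightarrow> real).
           (\<forall>i<k. \<forall>j<k. e i \<bullet> e j = (if i = j then 1 else 0)) \<and>
           span (e ` {..<k}) = orthogonal_comp {v. \<Lambda> *v v = 0} \<and>
           (\<forall>j<k. eigenvector \<Lambda> (l j) (e j)) \<and>
           (\<forall>i j. i \<le> j \<and> j < k \<longrightarrow> l j \<le> l i) \<longrightarrow>
           (\<forall>j<k. l j > 0) \<and>
           (let w = (\<lambda>j y. l j powr (-1/2) * T' (e j) y) in
             (\<forall>j<k. AE y in M. w j y =
                l j powr (-1/2) * (\<Sum>i\<in>UNIV. \<nu> $ i * e j $ i * \<rho> (p i) y)) \<and>
             L2_orthonormal_basis M (L2_orthogonal_comp M (L2_kernel M S)) k w \<and>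
             (\<forall>j<k. L2_eigenfunction M S (l j) (w j)))) \<and>
         (L2_has_dim M (L2_orthogonal_comp M (L2_kernel M S)) k)"
proof -
  let ?r = "\<lambda>i. \<rho> (p i)"
  let ?R = "\<lambda>v y. \<Sum>i\<in>UNIV. \<nu> $ i * v $ i * \<rho> (p i) y"
  have "\<Gamma>\<^sub>1 \<inter> space \<sigma> \<in> sets \<sigma>"
    using \<open>\<Gamma>\<^sub>1 \<subseteq> frontier D\<close> \<open>\<Gamma>\<^sub>1 \<in> sets borel\<close> sets_eq_imp_space_eq[OF sets_boundary_measure[of D]]
    by (auto simp: \<sigma>_def sets_boundary_measure sets_restrict_space space_restrict_space image_iff)
  then have r: "?r i \<in> L2 M" for i
    using assms unfolding M_def by (intro L2_restrict_space) auto
  have R: "is_L2_adjoint M T ?R"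
    unfolding T_def using r by (rule T_op_is_L2_adjoint)
  \<comment> \<open>The explicit formula witnesses existence, so the choice operator returns an
    adjoint.\<close>
  then have adj: "is_L2_adjoint M T T'"
    unfolding T'_def L2_adjoint_def by (rule someI[where P="is_L2_adjoint M T"])
  then interpret L2_adjoint_pair M T T' by unfold_locales
  have T'_eq: "AE y in M. T' v y = ?R v y" for v
    by (rule adjoint_unique_AE[OF R])
  have Lambda: "T (T' v) = \<Lambda> *v v" for v
  proof -
    \<comment> \<open>\<open>T\<close> does not distinguish functions equal almost everywhere, so
      the matrix identity is exact for the chosen adjoint as well.\<close>
    have "T (T' v) = T (?R v)"
      using R T'_eq by (intro T_cong_AE) (auto simp: is_L2_adjoint_def)
    then show ?thesis
      unfolding T_def \<Lambda>_def using T_op_sum_eq_Lambda_mat[of ?r M \<nu> v] r by simp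
  qed
  have k: "k = dim (orthogonal_comp {v. T (T' v) = 0})" by (simp add: k_def Lambda)
  have eig: "eigenvector \<Lambda> l v \<longleftrightarrow> v \<noteq> 0 \<and> T (T' v) = l *\<^sub>R v" for l v
    by (simp add: eigenvector_def Lambda)
  have "L2_eigenfunction M S l u \<longleftrightarrow>
      (\<exists>v. eigenvector \<Lambda> l v \<and> (AE y in M. u y = T' v y) \<and> (AE y in M. u y = ?R v y))"
    if "l \<noteq> 0" "u \<in> L2 M" for l u
  proof -
    have "AE y in M. u y = ?R v y" if "AE y in M. u y = T' v y" for v
      using that T'_eq[of v] by eventually_elim simp
    then show ?thesis
      unfolding S_def eigenfunction_iff[OF that] eig by blast
  qed
  moreover have "(\<forall>j<k. l j > 0) \<and> (let w = (\<lambda>j y. l j powr (-1/2) * T' (e j) y) in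
       (\<forall>j<k. AE y in M. w j y = l j powr (-1/2) * ?R (e j) y) \<and>
       L2_orthonormal_basis M (L2_orthogonal_comp M (L2_kernel M S)) k w \<and>
       (\<forall>j<k. L2_eigenfunction M S (l j) (w j)))"
    if orthonormal: "\<forall>i<k. \<forall>j<k. e i \<bullet> e j = (if i = j then 1 else 0)"
      and span: "span (e ` {..<k}) = orthogonal_comp {v. \<Lambda> *v v = 0}"
      and ev: "\<forall>j<k. eigenvector \<Lambda> (l j) (e j)" for e l
  proof -
    have pos: "l j > 0" if "j < k" for j
    proof (rule eigenvalue_pos)
      show "e j \<in> orthogonal_comp {v. T (T' v) = 0}"
        unfolding Lambda span[symmetric] using that by (intro span_base) auto
    qed (use ev that eig in auto)
    have "L2_eigenfunction M S (l j) (\<lambda>y. l j powr (-1/2) * T' (e j) y)" if "j < k" for j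
    proof -
      \<comment> \<open>Up to a null set, \<open>T'\<close> of the rescaled eigenvector is the
        rescaled function, which reduces the claim to \<open>eigenfunction_iff\<close>.\<close>
      let ?v = "(l j powr (-1/2)) *\<^sub>R e j"
      have "?v \<noteq> 0" "T (T' ?v) = l j *\<^sub>R ?v"
        using pos[OF that] ev that by (auto simp: eig Lambda matrix_vector_mult_scaleR)
      then show ?thesis
        unfolding S_def using pos[OF that] adjoint_scale[of "l j powr (-1/2)" "e j"]
        by (subst eigenfunction_iff) (auto simp: L2_scale intro!: exI[of _ ?v])
    qed
    moreover have "AE y in M. l j powr (-1/2) * T' (e j) y = l j powr (-1/2) * ?R (e j) y" for j
      using T'_eq[of "e j"] by eventually_elim simp
    moreover have "L2_orthonormal_basis M (L2_orthogonal_comp M (L2_kernel M S)) k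
        (\<lambda>j y. l j powr (-1/2) * T' (e j) y)"
      unfolding S_def using orthonormal span ev pos
      by (intro adjoint_orthonormal_basis) (auto simp: Lambda eigenvector_def)
    ultimately show ?thesis using pos by (simp add: Let_def)
  qed
  moreover have "k \<le> CARD('m)" unfolding k_def by (rule dim_subset_UNIV_cart)
  moreover have "L2_has_dim M (L2_orthogonal_comp M (L2_kernel M S)) k"
    unfolding S_def k by (rule orthogonal_comp_kernel_dim)
  moreover have "(\<exists>v. eigenvector \<Lambda> l v) \<longleftrightarrow> (\<exists>u. L2_eigenfunction M S l u)" if "l \<noteq> 0" for l
    unfolding S_def eig by (rule eigenvalue_iff[OF that])
  ultimately show ?thesis
    using adj T'_eq Lambda by blast
qed

end
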